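(* Let $K\ge 2$ be an integer, let $0<p_i<1$ ($i=1,\dots,K$) with $\sum_{i=1}^K p_i=1$, and let $0\le\delta\le 1$. Let $N\ge 1$ and let $\epsilon_1,\dots,\epsilon_N$ be a sequence of dependent categorical random variables with categories $\{1,\dots,K\}$, probabilities $p_1,\dots,p_K$ and dependency coefficient $\delta$ (as defined in the context). Then for every $r\in\{1,\dots,N\}$ and every $i\in\{1,\dots,K\}$, $$P(\epsilon_r=i)=p_i .$$ As $N\ge 1$ is arbitrary, this covers every $r\in\mathbb{N}$, $r\ge 1$.
   Context: For $i=1,\dots,K$ put $p_i^{+}:=p_i+\delta\sum_{l\ne i}p_l$ and $p_i^{-}:=p_i-\delta p_i$. A sequence of dependent categorical random variables $\epsilon_1,\dots,\epsilon_N$ with categories $\{1,\dots,K\}$, probabilities $p_1,\dots,p_K$ and dependency coefficient $\delta$ is a sequence of $\{1,\dots,K\}$-valued random variables on a common probability space whose joint distribution is $$P(\epsilon_1=e_1,\dots,\epsilon_N=e_N)=p_{e_1}\prod_{j=2}^{N} w(e_1,e_j),\qquad w(i,k):=\begin{cases}p_i^{+}, & k=i,\\ p_k^{-}, & k\ne i,\end{cases}$$ for all $(e_1,\dots,e_N)\in\{1,\dots,K\}^N$ (empty product equal to $1$ when $N=1$). *)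

theory Defs
  imports "HOL-Probability.Probability"
begin

definition p_plus :: "nat \<Rightarrow> (nat \<Rightarrow> real) \<Rightarrow> real \<Rightarrow> nat \<Rightarrow> real" where
  "p_plus K p \<delta> i = p i + \<delta> * (\<Sum>l\<in>{1..K} - {i}. p l)"

definition p_minus :: "(nat \<Rightarrow> real) \<Rightarrow> real \<Rightarrow> nat \<Rightarrow> real" where
  "p_minus p \<delta> i = p i - \<delta> * p i"

definition dep_weight :: "nat \<Rightarrow> (nat \<Rightarrow> real) \<Rightarrow> real \<Rightarrow> nat \<Rightarrow> nat \<Rightarrow> real" where
  "dep_weight K p \<delta> i k = (if k = i then p_plus K p \<delta> i else p_minus p \<delta> k)"

(* Only p 1, ..., p K and eps 1, ..., eps N are relevant.  Measurability into
   count_space {1..K} includes that eps j takes its values in {1..K} on space M. *)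
definition dependent_categorical ::
  "'a measure \<Rightarrow> nat \<Rightarrow> (nat \<Rightarrow> real) \<Rightarrow> real \<Rightarrow> nat \<Rightarrow> (nat \<Rightarrow> 'a \<Rightarrow> nat) \<Rightarrow> bool" where
  "dependent_categorical M K p \<delta> N eps \<longleftrightarrow>
     prob_space M \<and>
     (\<forall>j\<in>{1..N}. eps j \<in> M \<rightarrow>\<^sub>M count_space {1..K}) \<and>
     (\<forall>e \<in> {1..N} \<rightarrow>\<^sub>E {1..K}.
        \<P>(x in M. \<forall>j\<in>{1..N}. eps j x = e j)
          = p (e 1) * (\<Prod>j=2..N. dep_weight K p \<delta> (e 1) (e j)))"

end

theory Submission
  imports Defs
begin

text \<open>
  Because the \<open>p l\<close> sum to \<open>1\<close>, the weight is a mixture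
  \<open>w(a,k) = \<delta> [k = a] + (1 - \<delta>) p k\<close>: each later variable repeats the first one with
  probability \<open>\<delta>\<close> and is otherwise drawn afresh from \<open>p\<close>. Hence the rows of \<open>w\<close> sum to \<open>1\<close>
  (\<open>sum_dep_weight\<close>) and \<open>p\<close> is a stationary distribution (\<open>dep_weight_stationary\<close>).

  Given the first variable, the joint probability is a product over the other indices, so the
  probability of a box \<open>\<forall>j. eps j \<in> B j\<close> factors as well
  (\<open>dependent_categorical_prob_box\<close>). The event \<open>eps r = i\<close> is the box that restricts only
  coordinate \<open>r\<close>. Since the rows of \<open>w\<close> sum to \<open>1\<close>, every unrestricted coordinate after the
  first contributes a factor \<open>1\<close>; what is left is
  \<open>p i\<close> if \<open>r = 1\<close>, and \<open>\<Sum>a. p a * w(a,i) = p i\<close> otherwise.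
\<close>

text \<open>
  The mixture form: the mass that \<open>p_plus\<close> moves to the category of the first variable is
  \<open>\<delta> (1 - p i)\<close>, exactly what \<open>p_minus\<close> removes from the other categories.
\<close>

lemma dep_weight_eq_mixture:
  assumes "(\<Sum>l=1..K. p l) = 1" and "i \<in> {1..K}"
  shows "dep_weight K p \<delta> i k = \<delta> * (if k = i then 1 else 0) + (1 - \<delta>) * p k"
proof -
  have "(\<Sum>l\<in>{1..K} - {i}. p l) = 1 - p i"
    using assms by (simp add: sum_diff1)
  then show ?thesis
    by (simp only: dep_weight_def p_plus_def p_minus_def) (simp add: algebra_simps)
qed

lemma sum_dep_weight:
  assumes "(\<Sum>l=1..K. p l) = 1" and "i \<in> {1..K}"
  shows "(\<Sum>k=1..K. dep_weight K p \<delta> i k) = 1"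
proof -
  have "(\<Sum>k=1..K. dep_weight K p \<delta> i k)
      = \<delta> * (\<Sum>k=1..K. if k = i then 1 else 0) + (1 - \<delta>) * (\<Sum>k=1..K. p k)"
    by (simp only: dep_weight_eq_mixture[OF assms] sum.distrib sum_distrib_left)
  also have "\<dots> = 1"
    using assms by (simp)
  finally show ?thesis .
qed

lemma dep_weight_stationary:
  assumes "(\<Sum>l=1..K. p l) = 1" and "k \<in> {1..K}"
  shows "(\<Sum>a=1..K. p a * dep_weight K p \<delta> a k) = p k"
proof -
  have "(\<Sum>a=1..K. p a * dep_weight K p \<delta> a k)
      = (\<Sum>a=1..K. \<delta> * (if k = a then p a else 0) + (1 - \<delta>) * p k * p a)"
    by (intro sum.cong refl) (simp add: dep_weight_eq_mixture[OF assms(1)] algebra_simps)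
  also have "\<dots> = \<delta> * (\<Sum>a=1..K. if k = a then p a else 0) + (1 - \<delta>) * p k * (\<Sum>a=1..K. p a)"
    by (simp only: sum.distrib sum_distrib_left)
  also have "\<dots> = p k"
    using assms by (simp add: algebra_simps)
  finally show ?thesis .
qed

text \<open>
  Distributivity for a product whose factors share one coordinate: fixing the value at \<open>c\<close>
  decouples the remaining coordinates.
\<close>

lemma sum_PiE_prod_shared:
  fixes f :: "'b \<Rightarrow> 'c :: comm_semiring_1"
  assumes "finite I" and "c \<notin> I" and "\<And>j. j \<in> I \<Longrightarrow> finite (B j)"
  shows "(\<Sum>e\<in>PiE (insert c I) B. f (e c) * (\<Prod>j\<in>I. g (e c) (e j)))
       = (\<Sum>a\<in>B c. f a * (\<Prod>j\<in>I. \<Sum>k\<in>B j. g a k))"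
proof -
  have "(\<Sum>e\<in>PiE (insert c I) B. f (e c) * (\<Prod>j\<in>I. g (e c) (e j)))
      = (\<Sum>(a, e)\<in>B c \<times> PiE I B. f a * (\<Prod>j\<in>I. g a (e j)))"
    unfolding PiE_insert_eq
  proof (subst sum.reindex[OF inj_combinator[OF assms(2)]], intro sum.cong refl, clarsimp)
    fix a e
    have "(\<Prod>j\<in>I. g a (if j = c then a else e j)) = (\<Prod>j\<in>I. g a (e j))"
      using assms(2) by (intro prod.cong) auto
    then show "f a * (\<Prod>j\<in>I. g a (if j = c then a else e j)) = f a * (\<Prod>j\<in>I. g a (e j))"
      by simp
  qed
  also have "\<dots> = (\<Sum>a\<in>B c. f a * (\<Sum>e\<in>PiE I B. \<Prod>j\<in>I. g a (e j)))"
    by (simp add: sum.cartesian_product sum_distrib_left)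
  also have "\<dots> = (\<Sum>a\<in>B c. f a * (\<Prod>j\<in>I. \<Sum>k\<in>B j. g a k))"
    using assms by (simp add: prod_sum_PiE)
  finally show ?thesis .
qed

text \<open>
  A box is the disjoint union of its finitely many points, whose probabilities are given by the
  joint distribution.
\<close>

lemma dependent_categorical_prob_box:
  assumes dep: "dependent_categorical M K p \<delta> N eps" and "N \<ge> 1"
    and B: "\<And>j. j \<in> {1..N} \<Longrightarrow> B j \<subseteq> {1..K}"
  shows "\<P>(x in M. \<forall>j\<in>{1..N}. eps j x \<in> B j)
       = (\<Sum>a\<in>B 1. p a * (\<Prod>j=2..N. \<Sum>k\<in>B j. dep_weight K p \<delta> a k))"
proof -
  interpret prob_space M
    using dep by (simp add: dependent_categorical_def)
  have meas: "eps j \<in> M \<rightarrow>\<^sub>M count_space {1..K}" if "j \<in> {1..N}" for j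
    using dep that by (simp add: dependent_categorical_def)
  define A where "A e = {x \<in> space M. \<forall>j\<in>{1..N}. eps j x = e j}" for e
  have finB: "finite (B j)" if "j \<in> {1..N}" for j
    using B[OF that] finite_subset by blast
  have A_sets: "A e \<in> events" for e
  proof -
    have "{x \<in> space M. eps j x = e j} \<in> events" if "j \<in> {1..N}" for j
    proof -
      have "eps j -` ({e j} \<inter> {1..K}) \<inter> space M \<in> events"
        by (rule measurable_sets[OF meas[OF that]]) simp
      also have "eps j -` ({e j} \<inter> {1..K}) \<inter> space M = {x \<in> space M. eps j x = e j}"
        using measurable_space[OF meas[OF that]] by (auto simp del: atLeastAtMost_iff)
      finally show ?thesis .
    qed
    then show ?thesis
      unfolding A_def by (intro sets.sets_Collect_finite_All) auto
  qed
  have box: "{x \<in> space M. \<forall>j\<in>{1..N}. eps j x \<in> B j} = (\<Union>e\<in>PiE {1..N} B. A e)"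
  proof (intro set_eqI iffI)
    fix x assume x: "x \<in> {x \<in> space M. \<forall>j\<in>{1..N}. eps j x \<in> B j}"
    have "(\<lambda>j\<in>{1..N}. eps j x) \<in> PiE {1..N} B" "x \<in> A (\<lambda>j\<in>{1..N}. eps j x)"
      using x by (auto simp: A_def)
    then show "x \<in> (\<Union>e\<in>PiE {1..N} B. A e)" by blast
  next
    fix x assume "x \<in> (\<Union>e\<in>PiE {1..N} B. A e)"
    then show "x \<in> {x \<in> space M. \<forall>j\<in>{1..N}. eps j x \<in> B j}"
      by (force simp: A_def PiE_iff)
  qed
  have disj: "disjoint_family_on A (PiE {1..N} B)"
  proof (unfold disjoint_family_on_def, intro ballI impI equals0I)
    fix d e x assume "d \<in> PiE {1..N} B" "e \<in> PiE {1..N} B" "d \<noteq> e" "x \<in> A d \<inter> A e"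
    moreover from this(4) have "d j = e j" if "j \<in> {1..N}" for j
      using that by (force simp: A_def)
    ultimately show False
      by (metis PiE_ext)
  qed
  have split: "{1..N} = insert 1 {2..N}"
    using \<open>N \<ge> 1\<close> by auto
  have "\<P>(x in M. \<forall>j\<in>{1..N}. eps j x \<in> B j) = (\<Sum>e\<in>PiE {1..N} B. prob (A e))"
    unfolding box using A_sets disj finB
    by (intro finite_measure_finite_Union finite_PiE) auto
  also have "\<dots> = (\<Sum>e\<in>PiE {1..N} B. p (e 1) * (\<Prod>j=2..N. dep_weight K p \<delta> (e 1) (e j)))"
  proof (intro sum.cong refl)
    fix e assume "e \<in> PiE {1..N} B"
    moreover have "PiE {1..N} B \<subseteq> {1..N} \<rightarrow>\<^sub>E {1..K}"
      by (rule PiE_mono[OF B])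
    ultimately have "e \<in> {1..N} \<rightarrow>\<^sub>E {1..K}"
      by (rule rev_subsetD)
    then show "prob (A e) = p (e 1) * (\<Prod>j=2..N. dep_weight K p \<delta> (e 1) (e j))"
      using dep unfolding A_def by (simp only: dependent_categorical_def)
  qed
  also have "\<dots> = (\<Sum>a\<in>B 1. p a * (\<Prod>j=2..N. \<Sum>k\<in>B j. dep_weight K p \<delta> a k))"
    unfolding split using \<open>N \<ge> 1\<close> finB by (intro sum_PiE_prod_shared) auto
  finally show ?thesis .
qed

theorem lemma2:
  fixes M :: "'a measure" and K N :: nat and p :: "nat \<Rightarrow> real" and \<delta> :: real
    and eps :: "nat \<Rightarrow> 'a \<Rightarrow> nat"
  assumes "K \<ge> 2"
    and "\<And>i. i \<in> {1..K} \<Longrightarrow> 0 < p i \<and> p i < 1"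
    and "(\<Sum>i=1..K. p i) = 1"
    and "0 \<le> \<delta>" and "\<delta> \<le> 1"
    and "N \<ge> 1"
    and "dependent_categorical M K p \<delta> N eps"
  shows "\<forall>r\<in>{1..N}. \<forall>i\<in>{1..K}. \<P>(x in M. eps r x = i) = p i"
proof (intro ballI)
  fix r i assume r: "r \<in> {1..N}" and i: "i \<in> {1..K}"
  define B where "B j = (if j = r then {i} else {1..K})" for j
  have B_sub: "B j \<subseteq> {1..K}" for j
    using i by (simp add: B_def)
  have eps_range: "eps j x \<in> {1..K}" if "j \<in> {1..N}" "x \<in> space M" for j x
  proof -
    have "eps j \<in> M \<rightarrow>\<^sub>M count_space {1..K}"
      using assms(7) that(1) by (simp add: dependent_categorical_def)
    from measurable_space[OF this that(2)] show ?thesis by simp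
  qed
  have "{x \<in> space M. eps r x = i} = {x \<in> space M. \<forall>j\<in>{1..N}. eps j x \<in> B j}"
    using r eps_range by (auto simp: B_def simp del: atLeastAtMost_iff)
  then have "\<P>(x in M. eps r x = i)
      = (\<Sum>a\<in>B 1. p a * (\<Prod>j=2..N. \<Sum>k\<in>B j. dep_weight K p \<delta> a k))"
    using dependent_categorical_prob_box[OF assms(7,6) B_sub] by simp
  also have "\<dots> = (\<Sum>a\<in>B 1. p a * (\<Prod>j=2..N. if j = r then dep_weight K p \<delta> a i else 1))"
  proof (intro sum.cong prod.cong arg_cong2[where f = times] refl)
    fix a j assume "a \<in> B 1"
    then have "a \<in> {1..K}" using i by (auto simp: B_def split: if_splits)
    then show "(\<Sum>k\<in>B j. dep_weight K p \<delta> a k) = (if j = r then dep_weight K p \<delta> a i else 1)"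
      using sum_dep_weight[OF assms(3)] by (simp add: B_def)
  qed
  also have "\<dots> = (\<Sum>a\<in>B 1. p a * (if r = 1 then 1 else dep_weight K p \<delta> a i))"
    using r by (intro sum.cong refl) (auto simp: prod.delta)
  also have "\<dots> = p i"
    using dep_weight_stationary[OF assms(3) i] by (simp add: B_def)
  finally show "\<P>(x in M. eps r x = i) = p i" .
qed

end
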